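(* Let $a,b$ be integers with $\gcd(a,b)=1$, and let $j\ge 2$ be an integer. A positive integer $n$ satisfies $n^j\mid a^n-b^n$ if and only if its prime factorization can be written in the form $$n=p_1^{k_1}p_2^{k_2}\cdots p_r^{k_r}\qquad (r\ge 0,\ p_1<p_2<\dots<p_r \text{ primes},\ \text{all } k_i\ge 1),$$ where $p_1^{(j-1)k_1}$ divides $a-b$ if $p_1>2$, and divides $\operatorname{lcm}(a-b,a+b)$ if $p_1=2$; and $p_i^{(j-1)k_i}\mid a^{n_i}-b^{n_i}$ for $i=2,\dots,r$, where $n_i=p_1^{k_1}p_2^{k_2}\cdots p_{i-1}^{k_{i-1}}$. (The case $n=1$ corresponds to $r=0$.)
   Context: For integers $a,b$ and $j\ge 1$, $R^{(j)}_{a,b}$ denotes the set of positive integers $n$ such that $n^j$ divides $a^n-b^n$; the theorem describes $R^{(j)}_{a,b}$ for $j\ge 2$. *)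

theory Defs
  imports "HOL-Computational_Algebra.Primes"
begin

definition R :: "nat \<Rightarrow> int \<Rightarrow> int \<Rightarrow> nat set" where
  "R j a b = {n. n > 0 \<and> int n ^ j dvd a ^ n - b ^ n}"

end

theory Submission
  imports Defs "HOL-Number_Theory.Residues"
begin

text \<open>
  Write \<open>n = q p\<^sup>k s\<close> with \<open>p\<close> prime, where all primes dividing \<open>q\<close> are smaller and all primes
  dividing \<open>s\<close> are larger than \<open>p\<close>. If \<open>p\<close> divides \<open>a\<^sup>n - b\<^sup>n\<close>, then, as \<open>p\<^sup>k s\<close> is coprime
  to \<open>p - 1\<close>, Fermat's little theorem gives that \<open>p\<close> already divides \<open>a\<^sup>q - b\<^sup>q\<close>. For odd \<open>p\<close>,
  lifting the exponent shows that passing from the exponent \<open>q\<close> to \<open>n\<close> raises the \<open>p\<close>-adic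
  valuation by exactly \<open>k\<close>, so \<open>p\<^sup>j\<^sup>k\<close> divides \<open>a\<^sup>n - b\<^sup>n\<close> iff \<open>p\<close> to the power \<open>(j - 1) k\<close>
  divides \<open>a\<^sup>q - b\<^sup>q\<close>. For \<open>p = 2\<close> one lifts from \<open>a\<^sup>2 - b\<^sup>2\<close> instead, which is divisible by 4 and
  equals \<open>2 lcm (a - b, a + b)\<close> up to sign because \<open>gcd (a - b, a + b) = 2\<close>.
\<close>

section \<open>Reducing exponents modulo a prime\<close>

text \<open>Bezout in the form \<open>u * x = v * y + gcd u v\<close> keeps all exponents natural;
  after replacing \<open>b ^ (v * y)\<close> by \<open>a ^ (v * y)\<close>, this common factor is a
  unit modulo \<open>p\<close> and cancels.\<close>

lemma prime_dvd_power_diff_gcd: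
  fixes a b p :: int
  assumes "prime p" "\<not> p dvd a" "u \<noteq> 0"
    and "p dvd a ^ u - b ^ u" "p dvd a ^ v - b ^ v"
  shows "p dvd a ^ gcd u v - b ^ gcd u v"
proof -
  obtain x y where xy: "u * x = v * y + gcd u v"
    using bezout_nat[OF \<open>u \<noteq> 0\<close>] by blast
  have "[(a ^ u) ^ x = (b ^ u) ^ x] (mod p)" and v: "[(a ^ v) ^ y = (b ^ v) ^ y] (mod p)"
    using assms(4,5) by (auto simp: cong_iff_dvd_diff[symmetric] intro!: cong_pow)
  then have "[a ^ (v * y) * a ^ gcd u v = b ^ (v * y) * b ^ gcd u v] (mod p)"
    by (simp add: power_mult[symmetric] xy power_add)
  moreover have "[b ^ (v * y) * b ^ gcd u v = a ^ (v * y) * b ^ gcd u v] (mod p)"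
    using cong_sym[OF v] by (intro cong_mult) (auto simp: power_mult)
  ultimately have "[a ^ (v * y) * a ^ gcd u v = a ^ (v * y) * b ^ gcd u v] (mod p)"
    using cong_trans by blast
  moreover have "coprime (a ^ (v * y)) p"
    using prime_imp_coprime[OF assms(1,2)] by (simp add: coprime_commute)
  ultimately show ?thesis
    using cong_mult_lcancel cong_iff_dvd_diff by blast
qed

lemma fermat_theorem_int:
  fixes a :: int
  assumes "prime p" "\<not> int p dvd a"
  shows "[a ^ (p - 1) = 1] (mod int p)"
proof -
  define c where "c = nat (a mod int p)"
  have "p > 0" using assms(1) prime_gt_0_nat by blast
  then have c: "[int c = a] (mod int p)" by (simp add: c_def)
  then have "\<not> p dvd c"
    using assms(2) cong_dvd_iff[of "int c" a "int p"] by (metis cong_dvd_iff int_dvd_int_iff)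
  then have "[int c ^ (p - 1) = 1] (mod int p)"
    using fermat_theorem[OF assms(1)] by (metis cong_int_iff of_nat_1 of_nat_power)
  then show ?thesis
    using c cong_pow cong_trans cong_sym by blast
qed

text \<open>By Fermat, \<open>p\<close> also divides the difference for the exponent
  \<open>q * (p - 1)\<close>, and the gcd of \<open>q * (p - 1)\<close> and \<open>q * m\<close> is
  \<open>q\<close>.\<close>

lemma prime_dvd_power_diff_coprime_pred:
  fixes a b :: int
  assumes "prime p" "\<not> int p dvd a" "\<not> int p dvd b" "q > 0" "coprime m (p - 1)"
    and "int p dvd a ^ (q * m) - b ^ (q * m)"
  shows "int p dvd a ^ q - b ^ q"
proof -
  have "[a ^ (p - 1) = b ^ (p - 1)] (mod int p)"
    using fermat_theorem_int assms(1-3) cong_trans cong_sym by meson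
  then have "[(a ^ (p - 1)) ^ q = (b ^ (p - 1)) ^ q] (mod int p)"
    by (rule cong_pow)
  then have "int p dvd a ^ (q * (p - 1)) - b ^ (q * (p - 1))"
    by (simp add: cong_iff_dvd_diff power_mult[symmetric] mult.commute)
  moreover have "gcd (q * (p - 1)) (q * m) = q"
    using assms(5) by (simp add: gcd_mult_distrib_nat[symmetric] coprime_iff_gcd_eq_1 gcd.commute)
  moreover have "q * (p - 1) \<noteq> 0"
    using assms(1,4) prime_gt_1_nat[of p] by simp
  ultimately show ?thesis
    using prime_dvd_power_diff_gcd[of "int p" a "q * (p - 1)" b "q * m"] assms by auto
qed

section \<open>Lifting the exponent\<close>

text \<open>This is the first-order expansion of \<open>x ^ i\<close> around \<open>y\<close>,
  multiplied by \<open>y\<close> so that the exponent \<open>i - 1\<close> does not appear; the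
  error in each inductive step is a multiple of the square of \<open>x - y\<close>.\<close>

lemma mult_power_cong_linear:
  fixes x y p :: int
  assumes "p dvd x - y"
  shows "[y * x ^ i = y ^ i * (y + int i * (x - y))] (mod p\<^sup>2)"
proof (induction i)
  case (Suc i)
  have "[x * (y * x ^ i) = x * (y ^ i * (y + int i * (x - y)))] (mod p\<^sup>2)"
    using Suc by (rule cong_scalar_left)
  moreover have "x * (y ^ i * (y + int i * (x - y))) - y ^ Suc i * (y + int (Suc i) * (x - y))
      = y ^ i * int i * (x - y)\<^sup>2"
    by (simp add: algebra_simps power2_eq_square)
  then have "[x * (y ^ i * (y + int i * (x - y))) = y ^ Suc i * (y + int (Suc i) * (x - y))] (mod p\<^sup>2)"
    using assms by (simp add: cong_iff_dvd_diff)
  ultimately show ?case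
    using cong_trans by (fastforce simp: mult_ac)
qed simp

text \<open>The cofactor \<open>T\<close> of \<open>x - y\<close> in \<open>x ^ p - y ^ p\<close>
  contains the prime \<open>p\<close> exactly once.\<close>

lemma lifting_the_exponent_prime:
  fixes x y :: int
  assumes "prime p" "int p dvd x - y" "\<not> int p dvd y" "odd p \<or> 4 dvd x - y"
  shows "int p ^ Suc e dvd x ^ p - y ^ p \<longleftrightarrow> int p ^ e dvd x - y"
proof -
  define P where "P = int p"
  define T where "T = (\<Sum>i<p. y ^ (p - Suc i) * x ^ i)"
  have p: "p > 1" "prime P" using assms(1) prime_gt_1_nat by (auto simp: P_def)
  have T: "x ^ p - y ^ p = (x - y) * T"
    unfolding T_def by (rule power_diff_sumr2)
  have yT: "y * T = (\<Sum>i<p. y ^ (p - Suc i) * (y * x ^ i))"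
    unfolding T_def sum_distrib_left by (intro sum.cong refl) (rule mult.left_commute)
  \<comment> \<open>Expanding every summand to first order leaves \<open>P * y ^ p\<close> plus a
    term containing \<open>x - y\<close> times the sum of all \<open>i\<close> below
    \<open>p\<close>.\<close>
  have "[y * T = (\<Sum>i<p. y ^ (p - Suc i) * (y ^ i * (y + int i * (x - y))))] (mod P\<^sup>2)"
    unfolding yT using assms(2)
    by (intro cong_sum cong_scalar_left mult_power_cong_linear) (simp add: P_def)
  moreover have "(\<Sum>i<p. y ^ (p - Suc i) * (y ^ i * (y + int i * (x - y))))
      = (\<Sum>i<p. y ^ (p - 1) * (y + int i * (x - y)))"
    by (intro sum.cong refl) (simp add: mult.assoc[symmetric] power_add[symmetric])
  moreover have "\<dots> = y ^ (p - 1) * (P * y + (x - y) * (\<Sum>i<p. int i))"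
    by (simp add: P_def sum_distrib_left[symmetric] sum_distrib_right[symmetric] sum.distrib mult.commute)
  moreover have "\<dots> = P * y ^ p + y ^ (p - 1) * ((x - y) * (\<Sum>i<p. int i))"
    using p(1) by (simp add: distrib_left power_eq_if)
  ultimately have "P\<^sup>2 dvd y * T - P * y ^ p - y ^ (p - 1) * ((x - y) * (\<Sum>i<p. int i))"
    by (simp only: cong_iff_dvd_diff diff_diff_eq)
  \<comment> \<open>For odd \<open>p\<close> both factors are divisible by \<open>P\<close>. For
    \<open>p = 2\<close> the sum is 1, and divisibility of \<open>x - y\<close> by 4 has to supply
    both factors.\<close>
  moreover have "P\<^sup>2 dvd (x - y) * (\<Sum>i<p. int i)"
  proof (cases "odd p")
    case True
    have "2 * (\<Sum>i<p. int i) = P * (P - 1)" unfolding P_def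
      by (induction p) (auto simp: algebra_simps)
    then have "P dvd 2 * (\<Sum>i<p. int i)" by simp
    moreover have "coprime P 2" using True by (simp add: P_def)
    ultimately have "P dvd (\<Sum>i<p. int i)" by (simp add: coprime_dvd_mult_right_iff)
    then show ?thesis using assms(2) by (simp add: P_def power2_eq_square mult_dvd_mono)
  next
    case False
    then have "p = 2" using assms(1) primes_dvd_imp_eq two_is_prime_nat by blast
    then show ?thesis using assms(4) by (simp add: P_def numeral_2_eq_2)
  qed
  ultimately have *: "P * P dvd y * T - P * y ^ p"
    unfolding power2_eq_square by (metis dvd_add diff_add_cancel dvd_mult)
  then have "P dvd y * T - P * y ^ p" by (rule dvd_mult_left)
  then have "P dvd y * T" by (simp add: dvd_diff_left_iff)
  then have "P dvd T" using assms(3) p(2) by (auto simp: P_def prime_dvd_mult_iff)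
  then obtain S where S: "T = P * S" by blast
  have "P * P dvd P * (y * S - y ^ p)" using * by (simp add: S algebra_simps)
  then have "P dvd y * S - y ^ p" using p by (simp add: P_def)
  have "\<not> P dvd S"
  proof
    assume "P dvd S"
    with \<open>P dvd y * S - y ^ p\<close> have "P dvd y ^ p"
      by (simp add: dvd_diff_right_iff)
    then show False using prime_dvd_power[OF p(2)] assms(3) unfolding P_def by blast
  qed
  then have "coprime (P ^ e) S" using p(2) by (simp add: prime_imp_coprime)
  moreover have "P ^ Suc e dvd x ^ p - y ^ p \<longleftrightarrow> P ^ e dvd (x - y) * S"
    using p by (simp add: T S P_def)
  ultimately show ?thesis by (simp add: P_def coprime_dvd_mult_left_iff)
qed

text \<open>Here the cofactor of \<open>x - y\<close> is congruent to \<open>m * y ^ (m - 1)\<close>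
  modulo \<open>p\<close>, hence prime to \<open>p\<close>.\<close>

lemma lifting_the_exponent_coprime:
  fixes x y :: int
  assumes "prime p" "int p dvd x - y" "\<not> int p dvd y" "\<not> p dvd m"
  shows "int p ^ e dvd x ^ m - y ^ m \<longleftrightarrow> int p ^ e dvd x - y"
proof -
  define T where "T = (\<Sum>i<m. y ^ (m - Suc i) * x ^ i)"
  have p: "prime (int p)" using assms(1) by simp
  have T: "x ^ m - y ^ m = (x - y) * T"
    unfolding T_def by (rule power_diff_sumr2)
  have xy: "[x = y] (mod int p)" using assms(2) by (simp add: cong_iff_dvd_diff)
  have "[T = (\<Sum>i<m. y ^ (m - Suc i) * y ^ i)] (mod int p)"
    unfolding T_def using xy by (intro cong_sum cong_scalar_left cong_pow)
  also have "(\<Sum>i<m. y ^ (m - Suc i) * y ^ i) = (\<Sum>i<m. y ^ (m - 1))"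
    by (intro sum.cong refl) (simp add: power_add[symmetric])
  finally have "[T = int m * y ^ (m - 1)] (mod int p)" by simp
  moreover have "\<not> int p dvd int m * y ^ (m - 1)"
    using p assms(1,3,4) prime_dvd_power[OF p, of y] by (auto simp: prime_dvd_mult_iff)
  ultimately have "\<not> int p dvd T" by (simp add: cong_dvd_iff)
  then have "coprime (int p ^ e) T" using p by (simp add: prime_imp_coprime)
  then show ?thesis by (simp add: T coprime_dvd_mult_left_iff)
qed

text \<open>Each factor \<open>p\<close> of the exponent costs one use of the prime case; the part
  \<open>m\<close> prime to \<open>p\<close> is the base of the induction.\<close>

lemma lifting_the_exponent:
  fixes x y :: int
  assumes "prime p" "int p dvd x - y" "\<not> int p dvd y" "odd p \<or> 4 dvd x - y" "\<not> p dvd m"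
  shows "int p ^ (k + e) dvd x ^ (p ^ k * m) - y ^ (p ^ k * m) \<longleftrightarrow> int p ^ e dvd x - y"
proof (induction k arbitrary: e)
  case 0
  then show ?case using lifting_the_exponent_coprime assms by simp
next
  case (Suc k)
  let ?q = "p ^ k * m"
  \<comment> \<open>This carries divisibility by \<open>p\<close>, and by 4 where required, from
    \<open>x - y\<close> over to the powers.\<close>
  have d: "x - y dvd x ^ ?q - y ^ ?q" by (simp add: power_diff_sumr2)
  have "int p ^ Suc (k + e) dvd (x ^ ?q) ^ p - (y ^ ?q) ^ p
      \<longleftrightarrow> int p ^ (k + e) dvd x ^ ?q - y ^ ?q"
    using assms d prime_dvd_power[of "int p" y]
    by (intro lifting_the_exponent_prime) (auto intro: dvd_trans)
  moreover have "(z ^ ?q) ^ p = z ^ (p ^ Suc k * m)" for z :: int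
    unfolding power_mult[symmetric] by (rule arg_cong[of _ _ "power z"]) simp
  ultimately show ?case by (simp only: add_Suc Suc.IH)
qed

section \<open>Criteria at a single prime\<close>

text \<open>If \<open>p\<close> divides \<open>a ^ q - b ^ q\<close>, lifting applies to
  \<open>a ^ q\<close> and \<open>b ^ q\<close>. Otherwise the Fermat reduction shows that
  \<open>p\<close> does not divide \<open>a ^ n - b ^ n\<close> either, and both sides fail.\<close>

lemma prime_power_dvd_power_diff_iff:
  fixes a b :: int
  assumes "prime p" "odd p" "coprime a b" "q > 0" "c > 0"
    and s: "\<And>t. prime t \<Longrightarrow> t dvd s \<Longrightarrow> p < t"
    and n: "n = q * p ^ k * s"
  shows "int p ^ (k + c) dvd a ^ n - b ^ n \<longleftrightarrow> int p ^ c dvd a ^ q - b ^ q"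
proof -
  have P: "prime (int p)" using assms(1) by simp
  have ps: "\<not> p dvd s" using s assms(1) by blast
  have "s > 0" using ps by (cases s) auto
  then have "n > 0" using n \<open>q > 0\<close> assms(1) prime_gt_0_nat by simp
  \<comment> \<open>A prime dividing the difference and one of \<open>a\<close>, \<open>b\<close>
    would divide both, against coprimality.\<close>
  have pab: "\<not> int p dvd a \<and> \<not> int p dvd b" if "int p dvd a ^ i - b ^ i" "i > 0" for i
  proof -
    have "int p dvd a ^ i \<longleftrightarrow> int p dvd b ^ i"
      using that(1) by (simp add: cong_iff_dvd_diff[symmetric] cong_dvd_iff)
    then have "int p dvd a \<longleftrightarrow> int p dvd b"
      using P that(2) by (simp add: prime_dvd_power_iff)
    then show ?thesis using assms(3) P not_prime_unit coprime_common_divisor by blast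
  qed
  have main: "?thesis" if d: "int p dvd a ^ q - b ^ q"
  proof -
    have "\<not> int p dvd b ^ q" using pab[OF d assms(4)] P prime_dvd_power by blast
    then have "int p ^ (k + c) dvd (a ^ q) ^ (p ^ k * s) - (b ^ q) ^ (p ^ k * s)
       \<longleftrightarrow> int p ^ c dvd a ^ q - b ^ q"
      using assms(1,2) d ps by (intro lifting_the_exponent) auto
    then show ?thesis by (simp add: n power_mult[symmetric] mult.assoc)
  qed
  have "int p dvd a ^ q - b ^ q" if "int p dvd a ^ n - b ^ n"
  proof (rule prime_dvd_power_diff_coprime_pred)
    have p1: "p - 1 > 0" using assms(1) prime_gt_1_nat[of p] by simp
    \<comment> \<open>A common prime factor would be at most \<open>p - 1\<close>, whereas those of
      \<open>s\<close> exceed \<open>p\<close>.\<close>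
    have "coprime s (p - 1)"
    proof (rule ccontr)
      assume "\<not> coprime s (p - 1)"
      then obtain t where "prime t" "t dvd s" "t dvd p - 1"
        by (metis coprime_iff_gcd_eq_1 gcd_nat.bounded_iff prime_factor_nat)
      then show False using s[of t] dvd_imp_le[of t "p - 1"] p1 by auto
    qed
    moreover have "coprime p (p - 1)"
      using p1 by (intro coprime_diff_one_right_nat) simp
    ultimately show "coprime (p ^ k * s) (p - 1)" by simp
    show "int p dvd a ^ (q * (p ^ k * s)) - b ^ (q * (p ^ k * s))"
      using that by (simp add: n mult.assoc)
  qed (use assms pab[OF that \<open>n > 0\<close>] in auto)
  \<comment> \<open>As \<open>c\<close> is positive, each side would imply divisibility by
    \<open>p\<close> itself.\<close>
  then have "\<not> int p ^ (k + c) dvd a ^ n - b ^ n" "\<not> int p ^ c dvd a ^ q - b ^ q"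
    if "\<not> int p dvd a ^ q - b ^ q"
    using that assms(5) dvd_trans[OF dvd_power[of "k + c" "int p"]] dvd_trans[OF dvd_power[of c "int p"]]
    by auto
  then show ?thesis using main by blast
qed

text \<open>Lifting at 2 needs a difference divisible by 4, which the squares of odd numbers
  provide. One factor 2 of the exponent is spent on squaring; the factor 2 between the product of
  \<open>a - b\<close> and \<open>a + b\<close> and their lcm makes up for it.\<close>

lemma two_power_dvd_power_diff_iff:
  fixes a b :: int
  assumes "coprime a b" "k > 0" "c > 0" "odd s"
  shows "2 ^ (k + c) dvd a ^ (2 ^ k * s) - b ^ (2 ^ k * s) \<longleftrightarrow> 2 ^ c dvd lcm (a - b) (a + b)"
proof (cases "odd a \<and> odd b")
  case True
  obtain h where k: "k = Suc h" using assms(2) by (cases k) auto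
  have sq: "a\<^sup>2 - b\<^sup>2 = (a - b) * (a + b)" by (simp add: power2_eq_square algebra_simps)
  have "4 dvd a\<^sup>2 - b\<^sup>2"
  proof -
    have "2 * 2 dvd (a - b) * (a + b)" using True by (intro mult_dvd_mono) auto
    then show ?thesis using sq by simp
  qed
  \<comment> \<open>Since \<open>k = Suc h\<close>, the exponent \<open>h + Suc c\<close> equals
    \<open>k + c\<close>.\<close>
  then have "int 2 ^ (h + Suc c) dvd (a\<^sup>2) ^ (2 ^ h * s) - (b\<^sup>2) ^ (2 ^ h * s)
      \<longleftrightarrow> int 2 ^ Suc c dvd a\<^sup>2 - b\<^sup>2"
    using True assms(4) by (intro lifting_the_exponent) auto
  then have 1: "2 ^ (k + c) dvd a ^ (2 ^ k * s) - b ^ (2 ^ k * s) \<longleftrightarrow> 2 ^ Suc c dvd (a - b) * (a + b)"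
    by (simp add: k sq[symmetric] power_mult[symmetric] mult_ac)
  have "gcd (a - b) (a + b) = 2"
  proof -
    obtain u v where u: "a - b = 2 * u" and v: "a + b = 2 * v"
      using True by (meson dvdE even_add even_diff)
    have "a = u + v" "b = v - u" using u v by auto
    then have "coprime u v"
      using assms(1) by (metis coprimeI coprime_common_divisor dvd_add dvd_diff)
    then show ?thesis by (simp add: u v gcd_mult_distrib_int[symmetric] coprime_iff_gcd_eq_1)
  qed
  then have "\<bar>(a - b) * (a + b)\<bar> = 2 * lcm (a - b) (a + b)"
    using prod_gcd_lcm_int[of "a - b" "a + b"] by (simp add: abs_mult)
  then have "2 ^ Suc c dvd (a - b) * (a + b) \<longleftrightarrow> 2 ^ Suc c dvd 2 * lcm (a - b) (a + b)"
    by (metis dvd_abs_iff)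
  then show ?thesis using 1 by simp
next
  case False
  \<comment> \<open>Coprimality rules out that both are even, so the parities differ; both numbers
    to be divided are then odd, and both divisibilities fail.\<close>
  then have ab: "odd a \<longleftrightarrow> even b" using assms(1) coprime_common_divisor[of a b 2] by auto
  have "s > 0" using assms(4) by (cases s) auto
  then have "odd (a ^ (2 ^ k * s) - b ^ (2 ^ k * s))" using ab by auto
  moreover have "odd (lcm (a - b) (a + b))"
  proof -
    have "odd ((a - b) * (a + b))" using ab by auto
    moreover have "lcm (a - b) (a + b) dvd (a - b) * (a + b)" by (simp add: lcm_least)
    ultimately show ?thesis using dvd_trans by blast
  qed
  moreover have "even x" if "2 ^ c dvd x \<or> 2 ^ (k + c) dvd x" for x :: int
    using that assms(3) dvd_trans[OF dvd_power[of "k + c" "2::int"]]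
      dvd_trans[OF dvd_power[of c "2::int"]] by auto
  ultimately show ?thesis by blast
qed

section \<open>Combining the primes\<close>

lemma prod_dvd_iff_pairwise_coprime:
  fixes f :: "'a \<Rightarrow> int"
  assumes "finite A" "\<And>i j. i \<in> A \<Longrightarrow> j \<in> A \<Longrightarrow> i \<noteq> j \<Longrightarrow> coprime (f i) (f j)"
  shows "prod f A dvd d \<longleftrightarrow> (\<forall>i\<in>A. f i dvd d)"
  using assms
proof (induction A rule: finite_induct)
  case (insert x F)
  have "coprime (f x) (prod f F)"
    using insert.hyps by (intro prod_coprime_right insert.prems) auto
  then have "f x * prod f F dvd d \<longleftrightarrow> f x dvd d \<and> prod f F dvd d"
    by (metis divides_mult dvd_mult_left dvd_mult_right)
  moreover have "prod f F dvd d \<longleftrightarrow> (\<forall>i\<in>F. f i dvd d)"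
    by (rule insert.IH) (simp add: insert.prems)
  ultimately show ?case using insert.hyps by simp
qed simp

lemma ordered_prime_factorization:
  fixes n :: nat
  assumes "n > 0"
  obtains r p k where "\<forall>i\<in>{1..r::nat}. prime (p i :: nat) \<and> k i \<ge> 1"
    "strict_mono_on {1..r} p" "n = (\<Prod>i=1..r. p i ^ k i)"
proof -
  define xs where "xs = sorted_list_of_set (prime_factors n)"
  \<comment> \<open>List positions start at 0, the numbering of the primes at 1.\<close>
  define p where "p i = xs ! (i - 1)" for i
  have xs: "set xs = prime_factors n" "sorted_wrt (<) xs" "distinct xs" by (auto simp: xs_def)
  have "bij_betw (\<lambda>i. i - 1) {1..length xs} {..<length xs}"
    by (rule bij_betwI[where g = Suc]) auto
  then have bij: "bij_betw p {1..length xs} (prime_factors n)"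
    using bij_betw_trans[OF _ bij_betw_nth[OF xs(3) refl xs(1)[symmetric]]]
    by (simp add: p_def[abs_def] o_def)
  show thesis
  proof
    show "strict_mono_on {1..length xs} p"
      using xs(2) by (auto simp: strict_mono_on_def p_def sorted_wrt_iff_nth_less)
    have "n = (\<Prod>q\<in>prime_factors n. q ^ multiplicity q n)"
      using assms by (rule prime_factorization_nat)
    also have "\<dots> = (\<Prod>i=1..length xs. p i ^ multiplicity (p i) n)"
      by (rule prod.reindex_bij_betw[OF bij, symmetric])
    finally show "n = (\<Prod>i=1..length xs. p i ^ multiplicity (p i) n)" .
    have "p i \<in> prime_factors n" if "i \<in> {1..length xs}" for i
      using bij that bij_betwE by blast
    then show "\<forall>i\<in>{1..length xs}. prime (p i) \<and> multiplicity (p i) n \<ge> 1"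
      by (auto simp: in_prime_factors_iff prime_multiplicity_gt_zero_iff Suc_le_eq)
  qed
qed

text \<open>Stated for an arbitrary increasing factorization, so that it serves both directions of
  the theorem: \<open>int n ^ j\<close> splits into pairwise coprime prime powers, each tested by
  its own criterion.\<close>

lemma power_dvd_power_diff_iff:
  fixes a b :: int and r :: nat and p k :: "nat \<Rightarrow> nat"
  assumes "coprime a b" "j \<ge> 2"
    and pk: "\<forall>i\<in>{1..r}. prime (p i) \<and> k i \<ge> 1"
    and mono: "strict_mono_on {1..r} p"
    and n: "n = (\<Prod>i=1..r. p i ^ k i)"
  shows "int n ^ j dvd a ^ n - b ^ n \<longleftrightarrow>
       (r \<ge> 1 \<longrightarrow>
          (p 1 > 2 \<longrightarrow> int (p 1) ^ ((j - 1) * k 1) dvd a - b) \<and>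
          (p 1 = 2 \<longrightarrow> int (p 1) ^ ((j - 1) * k 1) dvd lcm (a - b) (a + b))) \<and>
       (\<forall>i\<in>{2..r}. int (p i) ^ ((j - 1) * k i) dvd
          a ^ (\<Prod>l=1..<i. p l ^ k l) - b ^ (\<Prod>l=1..<i. p l ^ k l))"
proof -
  let ?N = "\<lambda>i. \<Prod>l=1..<i. p l ^ k l"
  let ?S = "\<lambda>i. \<Prod>l=Suc i..r. p l ^ k l"
  have n_pow: "int n ^ j = (\<Prod>i=1..r. int (p i) ^ (j * k i))"
    by (simp add: n prod_power_distrib power_mult[symmetric] mult.commute)
  have "coprime (int (p i) ^ (j * k i)) (int (p l) ^ (j * k l))"
    if "i \<in> {1..r}" "l \<in> {1..r}" "i \<noteq> l" for i l
  proof -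
    have "p i \<noteq> p l" using that mono strict_mono_on_imp_inj_on inj_on_contraD by metis
    then have "coprime (p i) (p l)" using pk that by (simp add: primes_coprime)
    then show ?thesis by simp
  qed
  then have 1: "int n ^ j dvd a ^ n - b ^ n \<longleftrightarrow>
      (\<forall>i\<in>{1..r}. int (p i) ^ (j * k i) dvd a ^ n - b ^ n)"
    unfolding n_pow by (intro prod_dvd_iff_pairwise_coprime finite_atLeastAtMost)
  \<comment> \<open>Lifting contributes \<open>k i\<close>; the remaining
    \<open>(j - 1) * k i\<close> must already be present at the smaller exponent.\<close>
  have jk: "j * k i = k i + (j - 1) * k i" for i
    using assms(2) by (cases j) auto
  \<comment> \<open>The products \<open>?N i\<close> and \<open>?S i\<close> over the smaller and
    the larger primes take the roles of \<open>q\<close> and \<open>s\<close> in the criterion for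
    odd primes.\<close>
  have split: "n = ?N i * p i ^ k i * ?S i" and gt: "\<And>t. prime t \<Longrightarrow> t dvd ?S i \<Longrightarrow> p i < t"
    if i: "i \<in> {1..r}" for i
  proof -
    have "{1..r} = {1..<i} \<union> insert i {Suc i..r}" using i by auto
    then have "n = prod (\<lambda>l. p l ^ k l) ({1..<i} \<union> insert i {Suc i..r})" using n by simp
    also have "\<dots> = ?N i * prod (\<lambda>l. p l ^ k l) (insert i {Suc i..r})"
      by (rule prod.union_disjoint) auto
    finally show "n = ?N i * p i ^ k i * ?S i" by simp
    fix t :: nat assume t: "prime t" "t dvd ?S i"
    then obtain l where l: "l \<in> {Suc i..r}" "t dvd p l ^ k l"
      by (auto simp: prime_dvd_prod_iff)
    then have "t = p l" using t(1) pk i by (metis atLeastAtMost_iff le_trans le_SucI Suc_leD prime_dvd_power primes_dvd_imp_eq)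
    then show "p i < t" using mono i l(1) by (auto simp: strict_mono_on_def)
  qed
  have odd: "int (p i) ^ (j * k i) dvd a ^ n - b ^ n \<longleftrightarrow>
      int (p i) ^ ((j - 1) * k i) dvd a ^ ?N i - b ^ ?N i" if i: "i \<in> {1..r}" "p i > 2" for i
    unfolding jk
  proof (rule prime_power_dvd_power_diff_iff[OF _ _ assms(1) _ _ gt[OF i(1)] split[OF i(1)]])
    show "prime (p i)" using pk i by simp
    then show "odd (p i)" using i(2) prime_odd_nat by blast
    show "?N i > 0" using pk i(1) prime_gt_0_nat by (intro prod_pos) auto
    show "(j - 1) * k i > 0" using pk i(1) assms(2) by (auto simp: Suc_le_eq)
  qed
  have two: "int (p 1) ^ (j * k 1) dvd a ^ n - b ^ n \<longleftrightarrow>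
      int (p 1) ^ ((j - 1) * k 1) dvd lcm (a - b) (a + b)" if "r \<ge> 1" "p 1 = 2"
  proof -
    have 1: "1 \<in> {1..r}" using that by simp
    have "odd (?S 1)" using gt[OF 1, of 2] that by auto
    moreover have "k 1 > 0" "(j - 1) * k 1 > 0" using pk 1 assms(2) by (auto simp: Suc_le_eq)
    ultimately have "2 ^ (k 1 + (j - 1) * k 1) dvd a ^ (2 ^ k 1 * ?S 1) - b ^ (2 ^ k 1 * ?S 1)
      \<longleftrightarrow> 2 ^ ((j - 1) * k 1) dvd lcm (a - b) (a + b)"
      using two_power_dvd_power_diff_iff assms(1) by blast
    moreover have "n = 2 ^ k 1 * ?S 1" using split[OF 1] that by simp
    ultimately show ?thesis by (simp only: jk that of_nat_numeral)
  qed
  have ge2: "p i \<ge> 2" if "i \<in> {1..r}" for i using pk that prime_ge_2_nat by blast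
  \<comment> \<open>Only the first prime can be 2, so all later ones fall under the odd
    criterion.\<close>
  have gt2: "p i > 2" if "i \<in> {2..r}" for i
  proof -
    have "p 1 < p i" using mono that by (auto simp: strict_mono_on_def)
    moreover have "p 1 \<ge> 2" using ge2 that by simp
    ultimately show ?thesis by simp
  qed
  have "{1..r} = (if r \<ge> 1 then insert 1 {2..r} else {2..r})" by auto
  then have "int n ^ j dvd a ^ n - b ^ n \<longleftrightarrow>
      (r \<ge> 1 \<longrightarrow> int (p 1) ^ (j * k 1) dvd a ^ n - b ^ n) \<and>
      (\<forall>i\<in>{2..r}. int (p i) ^ (j * k i) dvd a ^ n - b ^ n)"
    unfolding 1 by auto
  also have "(\<forall>i\<in>{2..r}. int (p i) ^ (j * k i) dvd a ^ n - b ^ n) \<longleftrightarrow>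
      (\<forall>i\<in>{2..r}. int (p i) ^ ((j - 1) * k i) dvd a ^ ?N i - b ^ ?N i)"
    using odd gt2 by simp
  also have "(r \<ge> 1 \<longrightarrow> int (p 1) ^ (j * k 1) dvd a ^ n - b ^ n) \<longleftrightarrow> (r \<ge> 1 \<longrightarrow>
          (p 1 > 2 \<longrightarrow> int (p 1) ^ ((j - 1) * k 1) dvd a - b) \<and>
          (p 1 = 2 \<longrightarrow> int (p 1) ^ ((j - 1) * k 1) dvd lcm (a - b) (a + b)))"
  \<comment> \<open>For an odd first prime the product \<open>?N 1\<close> is empty, so the odd
    criterion speaks of \<open>a - b\<close>.\<close>
  proof (cases "r \<ge> 1")
    case True
    then consider "p 1 = 2" | "p 1 > 2" using ge2[of 1] by fastforce
    then show ?thesis using two odd[of 1] True by cases auto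
  qed simp
  finally show ?thesis .
qed

theorem theorem2:
  fixes a b :: int and j n :: nat
  assumes "gcd a b = 1" and "j \<ge> 2" and "n > 0"
  shows "n \<in> R j a b \<longleftrightarrow>
    (\<exists>(r::nat) (p::nat \<Rightarrow> nat) (k::nat \<Rightarrow> nat).
       (\<forall>i\<in>{1..r}. prime (p i) \<and> k i \<ge> 1) \<and>
       strict_mono_on {1..r} p \<and>
       n = (\<Prod>i=1..r. p i ^ k i) \<and>
       (r \<ge> 1 \<longrightarrow>
          (p 1 > 2 \<longrightarrow> int (p 1) ^ ((j - 1) * k 1) dvd a - b) \<and>
          (p 1 = 2 \<longrightarrow> int (p 1) ^ ((j - 1) * k 1) dvd lcm (a - b) (a + b))) \<and>
       (\<forall>i\<in>{2..r}.
          let n_i = (\<Prod>l=1..<i. p l ^ k l)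
          in int (p i) ^ ((j - 1) * k i) dvd a ^ n_i - b ^ n_i))"
proof -
  have ab: "coprime a b" using assms(1) by (simp add: coprime_iff_gcd_eq_1)
  have R: "n \<in> R j a b \<longleftrightarrow> int n ^ j dvd a ^ n - b ^ n" using assms(3) by (simp add: R_def)
  obtain r p k where f: "\<forall>i\<in>{1..r::nat}. prime (p i :: nat) \<and> k i \<ge> 1"
    "strict_mono_on {1..r} p" "n = (\<Prod>i=1..r. p i ^ k i)"
    using ordered_prime_factorization[OF assms(3)] .
  show ?thesis
    unfolding R Let_def
  proof (rule iffI, goal_cases)
    \<comment> \<open>The witness is the increasing factorization obtained above; the converse
      instead applies the criterion to whichever factorization is given.\<close>
    case 1
    then show ?case
      using f power_dvd_power_diff_iff[OF ab assms(2) f]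
      by (intro exI[of _ r] exI[of _ p] exI[of _ k] conjI) simp_all
  next
    case 2
    then show ?case
      by (elim exE conjE) (rule iffD2[OF power_dvd_power_diff_iff[OF ab assms(2)]], assumption+, intro conjI)
  qed
qed

end
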